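(* Consider the symmetric rigid body with rotor on ($I_1=I_2$, $\gamma>0$, $\rho>0$). Let $\theta_{max}$ be the maximal $\theta$ along the orbit through $\mathbf{L}=(l,0,0)$ and $s=\sin\theta_{max}$. The amount of somersault $\phi_2$ that occurs with rotor on, i.e. the advance of $\phi$ along the arc of this orbit between $\mathbf{L}=(l,0,0)$ and $\mathbf{L}=l(0,\cos\theta_{max},\sin\theta_{max})$ lying in $L_1\ge0$, $L_3\ge0$, is \[ \phi_2=\frac1s\left(k(1+2\gamma^{-1})K(k^2)-(k^{-1}-k)\,\Pi(2-k^{-2},k^2)\right), \qquad k^2=\frac{1-s^2}{2-s^2},\quad k>0. \]
   Context: Symmetric body with rotor: $I_1=I_2$, $\gamma=I_1/I_3-1$, $\rho=h/l$, where $I_i$ are the principal moments of inertia, $l>0$ the magnitude of the total angular momentum, and $(0,h,0)^t$ the constant internal angular momentum of the rotor. In dimensionless time $\tau=tl/I_1$ the equations of motion are $\phi'=1+\rho\sec\theta\sin\psi$, $\theta'=-\rho\cos\psi$, $\psi'=\gamma\sin\theta-\rho\tan\theta\sin\psi$, with conserved energy $E=\frac12(1+\gamma\sin^2\theta)+\frac12\rho(\rho+2\cos\theta\sin\psi)$. The body-frame angular momentum is $\mathbf{L}=(L_1,L_2,L_3)=l(\cos\theta\cos\psi,-\cos\theta\sin\psi,\sin\theta)$, so $(l,0,0)$ corresponds to $\theta=\psi=0$. The maximal tilt satisfies $\cos\theta_{max}=\sqrt{\beta^2+1}-\beta$ with $\beta=\rho/\gamma$. Complete elliptic integrals: $K(k^2)=\int_0^{\pi/2}\frac{d\alpha}{\sqrt{1-k^2\sin^2\alpha}}$,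 $\Pi(n,k^2)=\int_0^{\pi/2}\frac{d\alpha}{(1-n\sin^2\alpha)\sqrt{1-k^2\sin^2\alpha}}$. *)

theory Defs
  imports "HOL-Analysis.Analysis"
begin

(* Solutions in dimensionless time, in the coordinate chart -pi/2 < theta < pi/2.  The chart
   condition matters because ``1 / cos'' and ``tan'' are total functions in HOL.
   The angles phi and psi are real-valued lifts. *)
definition rotor_motion ::
  "real \<Rightarrow> real \<Rightarrow> (real \<Rightarrow> real) \<Rightarrow> (real \<Rightarrow> real) \<Rightarrow> (real \<Rightarrow> real) \<Rightarrow> bool" where
  "rotor_motion \<gamma> \<rho> \<phi> \<theta> \<psi> \<longleftrightarrow>
     (\<forall>t. - (pi / 2) < \<theta> t \<and> \<theta> t < pi / 2 \<and>
       (\<phi> has_real_derivative 1 + \<rho> * (1 / cos (\<theta> t)) * sin (\<psi> t)) (at t) \<and>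
       (\<theta> has_real_derivative - \<rho> * cos (\<psi> t)) (at t) \<and>
       (\<psi> has_real_derivative \<gamma> * sin (\<theta> t) - \<rho> * tan (\<theta> t) * sin (\<psi> t)) (at t))"

definition body_momentum :: "real \<Rightarrow> real \<Rightarrow> real \<Rightarrow> real ^ 3" where
  "body_momentum l \<theta> \<psi> = l *\<^sub>R vector [cos \<theta> * cos \<psi>, - cos \<theta> * sin \<psi>, sin \<theta>]"

(* The restriction of the curve L to [a, b] runs, in either direction, between P and Q and stays
   in the region L_1 >= 0, L_3 >= 0. *)
definition quadrant_arc :: "(real \<Rightarrow> real ^ 3) \<Rightarrow> real ^ 3 \<Rightarrow> real ^ 3 \<Rightarrow> real \<Rightarrow> real \<Rightarrow> bool" where
  "quadrant_arc L P Q a b \<longleftrightarrow> a < b \<and>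
     (L a = P \<and> L b = Q \<or> L a = Q \<and> L b = P) \<and>
     (\<forall>t\<in>{a..b}. 0 \<le> L t $ 1 \<and> 0 \<le> L t $ 3)"

(* The argument m of both elliptic integrals is the parameter k^2, not the modulus k. *)
definition ellipticK :: "real \<Rightarrow> real" where
  "ellipticK m = integral {0..pi / 2} (\<lambda>\<alpha>. 1 / sqrt (1 - m * (sin \<alpha>)\<^sup>2))"

definition ellipticPi :: "real \<Rightarrow> real \<Rightarrow> real" where
  "ellipticPi n m =
     integral {0..pi / 2} (\<lambda>\<alpha>. 1 / ((1 - n * (sin \<alpha>)\<^sup>2) * sqrt (1 - m * (sin \<alpha>)\<^sup>2)))"

end

theory Submission
  imports Defs
begin

text \<open>
  With $u = \sin\theta$ and $x = \cos\theta\cos\psi$, the third and first components of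
  $\mathbf{L}/l$, the equations of motion give $u' = -\rho x$, and on the energy level of
  $(l,0,0)$ the second component is $\gamma u^2/(2\rho)$. Hence $\mathbf{L}$ on the unit sphere
  reads $x^2 = 1 - u^2 - (\gamma u^2/2\rho)^2$. The right side vanishes at $u = s$, so it equals
  $(\gamma/2\rho)^2 (s^2 - u^2)(u^2 + s^2/(1-s^2))$, while $\phi' = 1 - (\gamma/2)\,u^2/(1-u^2)$
  depends on $u$ alone.

  On the arc $x \ge 0$, so $u$ decreases: the arc is run from the point of maximal tilt to
  $(l,0,0)$, which fixes the sign of the advance. The substitution $u = s\cos\alpha$ makes
  $\alpha$ rise from $0$ to $\pi/2$ with speed
  $\alpha' = (\gamma s/2k)\sqrt{1 - k^2\sin^2\alpha}$. Dividing $\phi'$ by this speed gives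
  $d\phi/d\alpha$ as a combination of the integrands of $K$ and $\Pi$; its integral over
  $[0,\pi/2]$ is the claimed value.

  The angle $\alpha = \arccos(u/s)$ is not obviously differentiable where $u = s$, so the
  substitution is carried out by showing that $\phi$ and the elliptic primitive evaluated at
  $\alpha$ have the same derivative in the open time interval and are continuous up to its ends.
  This needs $u < s$ after the start, that is $x > 0$, which holds because $x' > 0$ while $u > 0$
  (\<open>L1_pos_after_start\<close>).
\<close>

section \<open>The momentum components along a motion\<close>

text \<open>Twice the energy $E$, up to an additive constant.\<close>

lemma energy_conserved:
  assumes "rotor_motion \<gamma> \<rho> \<phi> \<theta> \<psi>"
  shows "\<gamma> * (sin (\<theta> t))\<^sup>2 + 2 * \<rho> * (cos (\<theta> t) * sin (\<psi> t)) =
         \<gamma> * (sin (\<theta> t'))\<^sup>2 + 2 * \<rho> * (cos (\<theta> t') * sin (\<psi> t'))"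
proof -
  let ?W = "\<lambda>t. \<gamma> * (sin (\<theta> t))\<^sup>2 + 2 * \<rho> * (cos (\<theta> t) * sin (\<psi> t))"
  have "(?W has_real_derivative 0) (at t)" for t
  proof -
    have th: "(\<theta> has_real_derivative - \<rho> * cos (\<psi> t)) (at t)"
      and ps: "(\<psi> has_real_derivative \<gamma> * sin (\<theta> t) - \<rho> * tan (\<theta> t) * sin (\<psi> t)) (at t)"
      and "cos (\<theta> t) > 0"
      using assms unfolding rotor_motion_def by (auto intro: cos_gt_zero_pi)
    then show ?thesis
      by (auto intro!: derivative_eq_intros th ps simp: tan_def field_simps power2_eq_square)
  qed
  then show ?thesis
    using DERIV_isconst_all by blast
qed

lemma L3_deriv:
  assumes "rotor_motion \<gamma> \<rho> \<phi> \<theta> \<psi>"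
  shows "((\<lambda>t. sin (\<theta> t)) has_real_derivative - \<rho> * (cos (\<theta> t) * cos (\<psi> t))) (at t)"
proof -
  have th: "(\<theta> has_real_derivative - \<rho> * cos (\<psi> t)) (at t)"
    using assms unfolding rotor_motion_def by auto
  show ?thesis
    by (auto intro!: derivative_eq_intros th)
qed

lemma L1_deriv:
  assumes "rotor_motion \<gamma> \<rho> \<phi> \<theta> \<psi>"
  shows "((\<lambda>t. cos (\<theta> t) * cos (\<psi> t)) has_real_derivative
           sin (\<theta> t) * (\<rho> - \<gamma> * (cos (\<theta> t) * sin (\<psi> t)))) (at t)"
proof -
  have th: "(\<theta> has_real_derivative - \<rho> * cos (\<psi> t)) (at t)"
    and ps: "(\<psi> has_real_derivative \<gamma> * sin (\<theta> t) - \<rho> * tan (\<theta> t) * sin (\<psi> t)) (at t)"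
    and c: "cos (\<theta> t) > 0"
    using assms unfolding rotor_motion_def by (auto intro: cos_gt_zero_pi)
  have "\<rho> * (cos (\<psi> t) * (cos (\<psi> t) * sin (\<theta> t))) +
      \<rho> * (sin (\<psi> t) * (sin (\<psi> t) * sin (\<theta> t))) =
      \<rho> * sin (\<theta> t) * ((cos (\<psi> t))\<^sup>2 + (sin (\<psi> t))\<^sup>2)"
    by (simp only: power2_eq_square distrib_left mult_ac)
  also have "\<dots> = \<rho> * sin (\<theta> t)"
    by simp
  finally have "\<rho> * (cos (\<psi> t) * (cos (\<psi> t) * sin (\<theta> t))) +
      \<rho> * (sin (\<psi> t) * (sin (\<psi> t) * sin (\<theta> t))) = \<rho> * sin (\<theta> t)" .
  with c have "- sin (\<theta> t) * (- \<rho> * cos (\<psi> t)) * cos (\<psi> t) +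
      - sin (\<psi> t) * (\<gamma> * sin (\<theta> t) - \<rho> * tan (\<theta> t) * sin (\<psi> t)) * cos (\<theta> t) =
      sin (\<theta> t) * (\<rho> - \<gamma> * (cos (\<theta> t) * sin (\<psi> t)))"
    by (simp add: tan_def power2_eq_square algebra_simps)
  then show ?thesis
    by (auto intro!: derivative_eq_intros th ps)
qed

text \<open>On the energy level of $(l,0,0)$ the angle $\psi$ drops out of the rate of $\phi$, because
  $\rho\sec\theta\sin\psi = \rho\cos\theta\sin\psi/\cos^2\theta$ and conservation gives the
  numerator.\<close>

lemma phi_deriv_zero_level:
  assumes "rotor_motion \<gamma> \<rho> \<phi> \<theta> \<psi>"
    and "\<gamma> * (sin (\<theta> t))\<^sup>2 + 2 * \<rho> * (cos (\<theta> t) * sin (\<psi> t)) = 0"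
  shows "(\<phi> has_real_derivative 1 + \<gamma> / 2 - \<gamma> / 2 / (1 - (sin (\<theta> t))\<^sup>2)) (at t)"
proof -
  have ph: "(\<phi> has_real_derivative 1 + \<rho> * (1 / cos (\<theta> t)) * sin (\<psi> t)) (at t)"
    and c: "cos (\<theta> t) > 0"
    using assms(1) unfolding rotor_motion_def by (auto intro: cos_gt_zero_pi)
  have "\<rho> * (1 / cos (\<theta> t)) * sin (\<psi> t) = \<rho> * (cos (\<theta> t) * sin (\<psi> t)) / (cos (\<theta> t))\<^sup>2"
    using c by (simp add: power2_eq_square)
  also have "\<rho> * (cos (\<theta> t) * sin (\<psi> t)) = - \<gamma> / 2 * (sin (\<theta> t))\<^sup>2"
    using assms(2) by simp
  also have "\<dots> / (cos (\<theta> t))\<^sup>2 = \<gamma> / 2 - \<gamma> / 2 / (cos (\<theta> t))\<^sup>2"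
    using c by (simp add: sin_squared_eq field_simps)
  finally show ?thesis
    using ph by (simp add: cos_squared_eq add_diff_eq)
qed

text \<open>The sphere equation $x^2 = 1 - u^2 - y^2$ with $y = -\cos\theta\sin\psi = \gamma u^2/(2\rho)$.\<close>

lemma L1_squared_zero_level:
  fixes \<gamma> \<rho> :: real
  assumes "\<rho> \<noteq> 0" and "\<gamma> * (sin \<theta>)\<^sup>2 + 2 * \<rho> * (cos \<theta> * sin \<psi>) = 0"
  shows "(cos \<theta> * cos \<psi>)\<^sup>2 = 1 - (sin \<theta>)\<^sup>2 - (\<gamma> / (2 * \<rho>))\<^sup>2 * ((sin \<theta>)\<^sup>2)\<^sup>2"
proof -
  have "cos \<theta> * sin \<psi> = - (\<gamma> / (2 * \<rho>)) * (sin \<theta>)\<^sup>2"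
    using assms by (simp add: field_simps)
  then have "(cos \<theta> * sin \<psi>)\<^sup>2 = (\<gamma> / (2 * \<rho>))\<^sup>2 * ((sin \<theta>)\<^sup>2)\<^sup>2"
    by (simp only: power_mult_distrib power2_minus)
  moreover have "(cos \<theta> * cos \<psi>)\<^sup>2 + (cos \<theta> * sin \<psi>)\<^sup>2 = (cos \<theta>)\<^sup>2"
    by (simp add: power_mult_distrib flip: distrib_left)
  ultimately show ?thesis
    by (simp add: cos_squared_eq)
qed

text \<open>
  Since $u = s$ is a root, the product of the roots of the quadratic in $u^2$ gives
  the other one, $-s^2/(1-s^2)$.
\<close>

lemma quartic_factorization:
  fixes d s u :: real
  assumes "s\<^sup>2 < 1" and "1 - s\<^sup>2 = d\<^sup>2 * (s\<^sup>2)\<^sup>2"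
  shows "1 - u\<^sup>2 - d\<^sup>2 * (u\<^sup>2)\<^sup>2 = d\<^sup>2 * ((s\<^sup>2 - u\<^sup>2) * (u\<^sup>2 + s\<^sup>2 / (1 - s\<^sup>2)))"
proof -
  have "s \<noteq> 0" using assms(2) by auto
  then have d: "d\<^sup>2 = (1 - s\<^sup>2) / (s\<^sup>2)\<^sup>2"
    using assms(2) by (simp add: field_simps)
  show ?thesis
    unfolding d using \<open>s\<^sup>2 < 1\<close> \<open>s \<noteq> 0\<close>
    by (simp add: divide_simps) (simp add: algebra_simps power2_eq_square power4_eq_xxxx)
qed

text \<open>
  A point where $x = 0$ is not an equilibrium: $x' > 0$ as long as $u > 0$, and once $u = 0$ the
  point is one of $x = \pm 1$.
\<close>

lemma L1_pos_after_start:
  assumes rot: "rotor_motion \<gamma> \<rho> \<phi> \<theta> \<psi>" and pos: "0 < \<gamma>" "0 < \<rho>"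
    and lev: "\<And>t. \<gamma> * (sin (\<theta> t))\<^sup>2 + 2 * \<rho> * (cos (\<theta> t) * sin (\<psi> t)) = 0"
    and x: "\<And>t. t \<in> {a..b} \<Longrightarrow> 0 \<le> cos (\<theta> t) * cos (\<psi> t)"
    and u: "\<And>t. t \<in> {a..b} \<Longrightarrow> 0 \<le> sin (\<theta> t)"
    and t: "a < t" "t \<le> b"
  shows "0 < cos (\<theta> t) * cos (\<psi> t)"
proof -
  let ?u = "\<lambda>t. sin (\<theta> t)" and ?x = "\<lambda>t. cos (\<theta> t) * cos (\<psi> t)"
  let ?x' = "\<lambda>t. ?u t * (\<rho> - \<gamma> * (cos (\<theta> t) * sin (\<psi> t)))"
  obtain \<xi> where \<xi>: "a < \<xi>" "\<xi> < t" "?x t - ?x a = (t - a) * ?x' \<xi>"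
    using MVT2[OF t(1), of ?x ?x'] L1_deriv[OF rot] by blast
  have "2 * \<rho> * (cos (\<theta> \<xi>) * sin (\<psi> \<xi>)) \<le> 0"
    using lev[of \<xi>] pos mult_nonneg_nonneg[of \<gamma> "(?u \<xi>)\<^sup>2"] by (smt (verit) zero_le_power2)
  then have "\<gamma> * (cos (\<theta> \<xi>) * sin (\<psi> \<xi>)) \<le> 0"
    using pos by (simp add: mult_le_0_iff zero_le_mult_iff)
  then have fac: "0 < \<rho> - \<gamma> * (cos (\<theta> \<xi>) * sin (\<psi> \<xi>))"
    using pos by linarith
  show ?thesis
  proof (cases "?u \<xi> = 0")
    case False
    then have "0 < ?u \<xi>" using u[of \<xi>] \<xi> t by auto
    with fac \<xi> have "0 < (t - a) * ?x' \<xi>" by simp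
    then show ?thesis using \<xi>(3) x[of a] t by auto
  next
    case True
    have "?u t \<le> ?u \<xi>"
    proof (rule DERIV_nonpos_imp_nonincreasing[OF less_imp_le[OF \<xi>(2)]])
      fix r assume r: "\<xi> \<le> r" "r \<le> t"
      have "- \<rho> * ?x r \<le> 0" using x[of r] r \<xi> t pos by auto
      then show "\<exists>y. (?u has_real_derivative y) (at r) \<and> y \<le> 0"
        using L3_deriv[OF rot] by blast
    qed
    then have "?u t = 0" using True u[of t] t by auto
    then have "(?x t)\<^sup>2 = 1"
      using L1_squared_zero_level[OF _ lev[of t]] pos by simp
    then have "?x t \<noteq> 0" by auto
    then show ?thesis using x[of t] t by (simp add: less_le)
  qed
qed

section \<open>Elliptic integrands\<close>

lemma elliptic_radicand_pos:
  fixes m :: real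
  assumes "m < 1"
  shows "0 < 1 - m * (sin \<alpha>)\<^sup>2"
proof -
  have *: "(sin \<alpha>)\<^sup>2 \<le> 1" "0 \<le> (sin \<alpha>)\<^sup>2"
    by (simp_all add: abs_square_le_1)
  show ?thesis
  proof (cases "m \<le> 0")
    case True
    then have "m * (sin \<alpha>)\<^sup>2 \<le> 0" using * by (simp add: mult_nonpos_nonneg)
    then show ?thesis by simp
  next
    case False
    then have "m * (sin \<alpha>)\<^sup>2 \<le> m" using * by (simp add: mult_left_le)
    then show ?thesis using assms by simp
  qed
qed

lemma continuous_on_ellipticK_integrand:
  fixes m :: real
  assumes "m < 1"
  shows "continuous_on A (\<lambda>\<alpha>. 1 / sqrt (1 - m * (sin \<alpha>)\<^sup>2))"
  using elliptic_radicand_pos[OF assms]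
  by (intro continuous_intros) (auto simp: less_le)

lemma continuous_on_ellipticPi_integrand:
  fixes m n :: real
  assumes "m < 1" "n < 1"
  shows "continuous_on A (\<lambda>\<alpha>. 1 / ((1 - n * (sin \<alpha>)\<^sup>2) * sqrt (1 - m * (sin \<alpha>)\<^sup>2)))"
  using elliptic_radicand_pos[OF assms(1)] elliptic_radicand_pos[OF assms(2)]
  by (intro continuous_intros) (auto simp: less_le)

text \<open>
  The change of variable in integrated form. Only continuity of \<open>\<alpha>\<close> is asked at the ends of the
  time interval, where an inverse trigonometric function may fail to be differentiable.
\<close>

lemma increment_by_substitution:
  fixes f \<alpha> :: "real \<Rightarrow> real"
  assumes "a < b" and g: "continuous_on {\<alpha> a..\<alpha> b} g"
    and f: "continuous_on {a..b} f" and \<alpha>: "continuous_on {a..b} \<alpha>"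
    and range: "\<And>t. t \<in> {a..b} \<Longrightarrow> \<alpha> t \<in> {\<alpha> a..\<alpha> b}"
    and inner: "\<And>t. t \<in> {a<..<b} \<Longrightarrow> \<alpha> a < \<alpha> t \<and> \<alpha> t < \<alpha> b"
    and d: "\<And>t. t \<in> {a<..<b} \<Longrightarrow> (\<alpha> has_real_derivative \<alpha>' t) (at t)"
    and fd: "\<And>t. t \<in> {a<..<b} \<Longrightarrow> (f has_real_derivative g (\<alpha> t) * \<alpha>' t) (at t)"
  shows "f b - f a = integral {\<alpha> a..\<alpha> b} g"
proof -
  define F where "F y = integral {\<alpha> a..y} g" for y
  have "continuous_on {\<alpha> a..\<alpha> b} F"
    unfolding F_def using indefinite_integral_continuous_1[OF integrable_continuous_real[OF g]] .
  then have cont: "continuous_on {a..b} (\<lambda>t. f t - F (\<alpha> t))"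
    using range by (intro continuous_on_diff f continuous_on_compose2[OF _ \<alpha>]) auto
  have "((\<lambda>t. f t - F (\<alpha> t)) has_real_derivative 0) (at t)" if t: "a < t" "t < b" for t
  proof -
    have i: "\<alpha> a < \<alpha> t" "\<alpha> t < \<alpha> b" using inner[of t] t by auto
    have "(F has_real_derivative g (\<alpha> t)) (at (\<alpha> t) within {\<alpha> a..\<alpha> b})"
      unfolding F_def using i by (intro integral_has_real_derivative[OF g]) auto
    then have "(F has_real_derivative g (\<alpha> t)) (at (\<alpha> t))"
      using i by (simp add: at_within_Icc_at)
    from DERIV_chain2[OF this d[of t]] t
    have "((\<lambda>t. F (\<alpha> t)) has_real_derivative g (\<alpha> t) * \<alpha>' t) (at t)" by simp
    from DERIV_diff[OF fd[of t] this] t show ?thesis by simp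
  qed
  from DERIV_isconst_end[OF \<open>a < b\<close> cont this]
  have "f b - F (\<alpha> b) = f a - F (\<alpha> a)" by simp
  then show ?thesis by (simp add: F_def)
qed

section \<open>The somersault on the arc\<close>

text \<open>
  Maximality of the tilt enters through $x = 0$ at the initial point, which makes $s$ a root of the
  quartic; the final point $u = 0$ corresponds to the upper limit $\alpha = \pi/2$.
\<close>

lemma somersault_from_tilt:
  assumes rot: "rotor_motion \<gamma> \<rho> \<phi> \<theta> \<psi>" and pos: "0 < \<gamma>" "0 < \<rho>"
    and lev: "\<And>t. \<gamma> * (sin (\<theta> t))\<^sup>2 + 2 * \<rho> * (cos (\<theta> t) * sin (\<psi> t)) = 0"
    and x: "\<And>t. t \<in> {a..b} \<Longrightarrow> 0 \<le> cos (\<theta> t) * cos (\<psi> t)"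
    and u: "\<And>t. t \<in> {a..b} \<Longrightarrow> 0 \<le> sin (\<theta> t)"
    and ab: "a < b" and ua: "sin (\<theta> a) = s" and xa: "cos (\<theta> a) * cos (\<psi> a) = 0"
    and ub: "sin (\<theta> b) = 0"
    and k: "k\<^sup>2 = (1 - s\<^sup>2) / (2 - s\<^sup>2)" "0 < k"
  shows "\<phi> b - \<phi> a =
    1 / s * (k * (1 + 2 * inverse \<gamma>) * ellipticK (k\<^sup>2)
      - (inverse k - k) * ellipticPi (2 - inverse (k\<^sup>2)) (k\<^sup>2))"
proof -
  let ?u = "\<lambda>t. sin (\<theta> t)" and ?x = "\<lambda>t. cos (\<theta> t) * cos (\<psi> t)"
  define d where "d = \<gamma> / (2 * \<rho>)"
  have d: "0 < d" using pos by (simp add: d_def)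
  have sph: "(?x t)\<^sup>2 = 1 - (?u t)\<^sup>2 - d\<^sup>2 * ((?u t)\<^sup>2)\<^sup>2" for t
    using L1_squared_zero_level[OF _ lev[of t]] pos unfolding d_def by simp
  have root: "1 - s\<^sup>2 = d\<^sup>2 * (s\<^sup>2)\<^sup>2"
    using sph[of a] ua xa by simp
  have "s \<noteq> 0" using root by auto
  moreover have "0 \<le> s" using u[of a] ua ab by auto
  ultimately have s: "0 < s" by simp
  have s1: "s\<^sup>2 < 1"
  proof -
    have "0 < d\<^sup>2 * (s\<^sup>2)\<^sup>2" using d s by simp
    then show ?thesis using root by linarith
  qed
  have xfac: "(?x t)\<^sup>2 = d\<^sup>2 * ((s\<^sup>2 - (?u t)\<^sup>2) * ((?u t)\<^sup>2 + s\<^sup>2 / (1 - s\<^sup>2)))" for t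
    using sph[of t] quartic_factorization[OF s1 root, of "?u t"] by simp

  have k1: "k\<^sup>2 < 1" using s1 by (simp add: k)
  have n: "2 - inverse (k\<^sup>2) = - (s\<^sup>2 / (1 - s\<^sup>2))"
    using s1 by (simp add: k field_simps)
  then have n1: "2 - inverse (k\<^sup>2) < 1"
    using s1 by (simp add: divide_nonneg_pos less_le_trans[of _ 0])
  have kinv: "inverse k - k = k / (1 - s\<^sup>2)"
  proof -
    have "inverse k - k = k * (inverse (k\<^sup>2) - 1)"
      using k(2) by (simp add: power2_eq_square field_simps)
    also have "inverse (k\<^sup>2) - 1 = 1 / (1 - s\<^sup>2)"
      using s1 by (simp add: k field_simps)
    finally show ?thesis by simp
  qed

  \<comment> \<open>With \<open>x > 0\<close>, the only factor that can change sign, \<open>s\<^sup>2 - u\<^sup>2\<close>, is positive.\<close>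
  have us: "?u t < s" if t: "t \<in> {a<..b}" for t
  proof -
    have "0 < ?x t" using L1_pos_after_start[OF rot pos lev x u, of a b t] t by auto
    then have "0 < (?x t)\<^sup>2" by (rule zero_less_power)
    moreover have "0 < (?u t)\<^sup>2 + s\<^sup>2 / (1 - s\<^sup>2)"
      using s s1 by (simp add: add_nonneg_pos)
    ultimately have "0 < s\<^sup>2 - (?u t)\<^sup>2"
      using d unfolding xfac by (simp add: zero_less_mult_iff)
    then show ?thesis using s by (simp add: power2_less_imp_less)
  qed
  have u0: "0 < ?u t" if t: "t \<in> {a..<b}" for t
  proof -
    have "?u b < ?u t"
    proof (rule DERIV_neg_imp_decreasing_open[of t b])
      show "t < b" using t by simp
      show "continuous_on {t..b} ?u"
        using L3_deriv[OF rot] by (meson DERIV_isCont continuous_at_imp_continuous_on)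
      fix r assume r: "t < r" "r < b"
      have "0 < ?x r" using L1_pos_after_start[OF rot pos lev x u, of a b r] r t by auto
      then have "- \<rho> * ?x r < 0" using pos by simp
      then show "\<exists>y. (?u has_real_derivative y) (at r) \<and> y < 0"
        using L3_deriv[OF rot] by blast
    qed
    then show ?thesis using ub by simp
  qed

  define \<alpha> where "\<alpha> t = arccos (?u t / s)" for t
  define \<alpha>' where "\<alpha>' t = \<gamma> / 2 * (s / k) * sqrt (1 - k\<^sup>2 * (sin (\<alpha> t))\<^sup>2)" for t
  define g where "g \<beta> = k / s * (1 + 2 * inverse \<gamma>) * (1 / sqrt (1 - k\<^sup>2 * (sin \<beta>)\<^sup>2))
     - (inverse k - k) / s * (1 / ((1 - (2 - inverse (k\<^sup>2)) * (sin \<beta>)\<^sup>2) * sqrt (1 - k\<^sup>2 * (sin \<beta>)\<^sup>2)))" for \<beta>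
  have q: "0 \<le> ?u t / s" "?u t / s \<le> 1" if "t \<in> {a..b}" for t
    using u[OF that] us[of t] ua s that by (cases "t = a"; auto)+
  have q': "0 < ?u t / s" "?u t / s < 1" if "t \<in> {a<..<b}" for t
    using u0[of t] us[of t] s that by auto
  have \<alpha>a: "\<alpha> a = 0" and \<alpha>b: "\<alpha> b = pi / 2"
    using ua ub s by (simp_all add: \<alpha>_def)
  have sin2: "(sin (\<alpha> t))\<^sup>2 = 1 - (?u t)\<^sup>2 / s\<^sup>2" if "t \<in> {a..b}" for t
    using q[OF that] by (simp add: sin_squared_eq \<alpha>_def cos_arccos power_divide)
  \<comment> \<open>Both factors of the elliptic denominators are quadratic polynomials in \<open>u\<close>.\<close>
  have rad: "(?u t)\<^sup>2 + s\<^sup>2 / (1 - s\<^sup>2) = (s / k)\<^sup>2 * (1 - k\<^sup>2 * (sin (\<alpha> t))\<^sup>2)" if "t \<in> {a..b}" for t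
  proof -
    have "(s / k)\<^sup>2 * (1 - k\<^sup>2 * (sin (\<alpha> t))\<^sup>2) = s\<^sup>2 * inverse (k\<^sup>2) - s\<^sup>2 * (sin (\<alpha> t))\<^sup>2"
      using k(2) by (simp add: field_simps)
    also have "\<dots> = s\<^sup>2 * (inverse (k\<^sup>2) - 1) + (?u t)\<^sup>2"
      using s by (simp add: sin2[OF that] field_simps)
    also have "inverse (k\<^sup>2) - 1 = 1 / (1 - s\<^sup>2)"
      using s1 by (simp add: k field_simps)
    finally show ?thesis by simp
  qed
  have pole: "1 - (2 - inverse (k\<^sup>2)) * (sin (\<alpha> t))\<^sup>2 = (1 - (?u t)\<^sup>2) / (1 - s\<^sup>2)" if "t \<in> {a..b}" for t
  proof -
    have "s\<^sup>2 / (1 - s\<^sup>2) * (1 - (?u t)\<^sup>2 / s\<^sup>2) = (s\<^sup>2 - (?u t)\<^sup>2) / (1 - s\<^sup>2)"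
      using s by (simp add: right_diff_distrib diff_divide_distrib)
    also have "1 + \<dots> = (1 - (?u t)\<^sup>2) / (1 - s\<^sup>2)"
      using s1 by (simp add: field_simps)
    finally show ?thesis
      by (simp add: n sin2[OF that])
  qed

  have \<alpha>deriv: "(\<alpha> has_real_derivative \<alpha>' t) (at t)" if t: "t \<in> {a<..<b}" for t
  proof -
    have t': "t \<in> {a..b}" using t by auto
    have D: "0 < s\<^sup>2 - (?u t)\<^sup>2"
      using u0[of t] us[of t] t by (simp add: power_strict_mono)
    have "?x t = sqrt ((?x t)\<^sup>2)" using x[OF t'] by simp
    also have "\<dots> = d * (sqrt (s\<^sup>2 - (?u t)\<^sup>2) * (s / k * sqrt (1 - k\<^sup>2 * (sin (\<alpha> t))\<^sup>2)))"
      unfolding xfac rad[OF t'] using d s k(2) by (simp add: real_sqrt_mult)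
    finally have X: "?x t = d * (sqrt (s\<^sup>2 - (?u t)\<^sup>2) * (s / k * sqrt (1 - k\<^sup>2 * (sin (\<alpha> t))\<^sup>2)))" .
    have "sqrt (1 - (?u t / s)\<^sup>2) = sqrt ((s\<^sup>2 - (?u t)\<^sup>2) / s\<^sup>2)"
      using s by (simp add: field_simps)
    then have S: "sqrt (1 - (?u t / s)\<^sup>2) = sqrt (s\<^sup>2 - (?u t)\<^sup>2) / s"
      using s by (simp add: real_sqrt_divide)
    have "((\<lambda>t. ?u t / s) has_real_derivative - \<rho> * ?x t / s) (at t)"
      using L3_deriv[OF rot] by (intro DERIV_cdivide)
    from DERIV_chain2[OF DERIV_arccos this] q'[OF t]
    have "(\<alpha> has_real_derivative inverse (- sqrt (1 - (?u t / s)\<^sup>2)) * (- \<rho> * ?x t / s)) (at t)"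
      unfolding \<alpha>_def[abs_def] by simp
    also have "inverse (- sqrt (1 - (?u t / s)\<^sup>2)) * (- \<rho> * ?x t / s) = \<rho> * ?x t / sqrt (s\<^sup>2 - (?u t)\<^sup>2)"
      unfolding S using s by (simp add: field_simps)
    also have "\<dots> = \<rho> * d * (s / k * sqrt (1 - k\<^sup>2 * (sin (\<alpha> t))\<^sup>2))"
      unfolding X using D by simp
    also have "\<dots> = \<alpha>' t"
      using pos by (simp add: \<alpha>'_def d_def)
    finally show ?thesis .
  qed

  have \<phi>deriv: "(\<phi> has_real_derivative g (\<alpha> t) * \<alpha>' t) (at t)" if t: "t \<in> {a<..<b}" for t
  proof -
    have t': "t \<in> {a..b}" using t by auto
    define R where "R = sqrt (1 - k\<^sup>2 * (sin (\<alpha> t))\<^sup>2)"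
    have R: "0 < R" unfolding R_def using elliptic_radicand_pos[OF k1] by simp
    define A B where "A = 1 - (?u t)\<^sup>2" and "B = 1 - s\<^sup>2"
    have "(?u t)\<^sup>2 < s\<^sup>2" using u0[of t] us[of t] t by (simp add: power_strict_mono)
    then have AB: "0 < A" "0 < B" using s1 unfolding A_def B_def by linarith+
    have "g (\<alpha> t) * \<alpha>' t = (k / s * (1 + 2 * inverse \<gamma>) * (1 / R) - k / B / s * (1 / (A / B * R)))
        * (\<gamma> / 2 * (s / k) * R)"
      unfolding g_def \<alpha>'_def pole[OF t'] kinv R_def A_def B_def by (rule refl)
    also have "\<dots> = k / s * (1 + 2 * inverse \<gamma>) * (1 / R) * (\<gamma> / 2 * (s / k) * R)
        - k / B / s * (1 / (A / B * R)) * (\<gamma> / 2 * (s / k) * R)"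
      by (rule left_diff_distrib)
    also have "k / s * (1 + 2 * inverse \<gamma>) * (1 / R) * (\<gamma> / 2 * (s / k) * R) = (1 + 2 * inverse \<gamma>) * (\<gamma> / 2)"
      using R s k(2) by simp
    also have "\<dots> = 1 + \<gamma> / 2"
      using pos by (simp add: field_simps)
    also have "k / B / s * (1 / (A / B * R)) * (\<gamma> / 2 * (s / k) * R) = \<gamma> / 2 / A"
      using R s k(2) AB by simp
    finally have "g (\<alpha> t) * \<alpha>' t = 1 + \<gamma> / 2 - \<gamma> / 2 / (1 - (?u t)\<^sup>2)"
      unfolding A_def .
    then show ?thesis
      using phi_deriv_zero_level[OF rot lev[of t]] by simp
  qed

  note cont = continuous_on_ellipticK_integrand[OF k1] continuous_on_ellipticPi_integrand[OF k1 n1]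
  have "\<phi> b - \<phi> a = integral {\<alpha> a..\<alpha> b} g"
  proof (rule increment_by_substitution[OF ab])
    show "continuous_on {\<alpha> a..\<alpha> b} g"
      unfolding g_def[abs_def]
      by (intro continuous_on_diff continuous_on_mult_left cont)
    show "continuous_on {a..b} \<phi>"
      using rot unfolding rotor_motion_def
      by (meson DERIV_isCont continuous_at_imp_continuous_on)
    have "continuous_on {a..b} ?u"
      using L3_deriv[OF rot] by (meson DERIV_isCont continuous_at_imp_continuous_on)
    then have "continuous_on {a..b} (\<lambda>t. ?u t / s)"
      using s by (intro continuous_on_divide continuous_on_const) auto
    moreover have "- 1 \<le> ?u t / s \<and> ?u t / s \<le> 1" if "t \<in> {a..b}" for t
      using q[OF that] by linarith
    ultimately show "continuous_on {a..b} \<alpha>"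
      unfolding \<alpha>_def[abs_def] by (intro continuous_on_arccos) blast+
    show "\<alpha> t \<in> {\<alpha> a..\<alpha> b}" if "t \<in> {a..b}" for t
      using q[OF that] arccos_lbound[of "?u t / s"] arccos_le_pi2[of "?u t / s"]
      unfolding \<alpha>a \<alpha>b by (simp add: \<alpha>_def)
    show "\<alpha> a < \<alpha> t \<and> \<alpha> t < \<alpha> b" if "t \<in> {a<..<b}" for t
      using q'[OF that] arccos_less_arccos[of "?u t / s" 1] arccos_less_arccos[of 0 "?u t / s"]
      unfolding \<alpha>a \<alpha>b by (simp add: \<alpha>_def)
  qed (use \<alpha>deriv \<phi>deriv in auto)
  also have "\<dots> = k / s * (1 + 2 * inverse \<gamma>) * ellipticK (k\<^sup>2)
      - (inverse k - k) / s * ellipticPi (2 - inverse (k\<^sup>2)) (k\<^sup>2)"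
    unfolding \<alpha>a \<alpha>b g_def[abs_def] ellipticK_def ellipticPi_def integral_mult_right[symmetric]
    by (intro integral_diff integrable_continuous_real continuous_on_mult_left cont)
  finally show ?thesis
    by (simp add: right_diff_distrib)
qed

theorem lemma5:
  fixes I1 I2 I3 l h \<gamma> \<rho> \<theta>max s k a b :: real
    and \<phi> \<theta> \<psi> :: "real \<Rightarrow> real"
  assumes "0 < I1" and "0 < I2" and "0 < I3" and "I1 = I2" and "0 < l"
    and "\<gamma> = I1 / I3 - 1" and "\<rho> = h / l"
    and "0 < \<gamma>" and "0 < \<rho>"
    and "rotor_motion \<gamma> \<rho> \<phi> \<theta> \<psi>"
    and "\<exists>t. body_momentum l (\<theta> t) (\<psi> t) = vector [l, 0, 0]"
    and "\<theta>max \<in> range \<theta>" and "\<forall>t. \<theta> t \<le> \<theta>max"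
    and "s = sin \<theta>max"
    and "quadrant_arc (\<lambda>t. body_momentum l (\<theta> t) (\<psi> t))
           (vector [l, 0, 0]) (l *\<^sub>R vector [0, cos \<theta>max, sin \<theta>max]) a b"
    and "k\<^sup>2 = (1 - s\<^sup>2) / (2 - s\<^sup>2)" and "0 < k"
  shows "\<phi> b - \<phi> a =
    1 / s * (k * (1 + 2 * inverse \<gamma>) * ellipticK (k\<^sup>2)
      - (inverse k - k) * ellipticPi (2 - inverse (k\<^sup>2)) (k\<^sup>2))"
proof -
  note rot = \<open>rotor_motion \<gamma> \<rho> \<phi> \<theta> \<psi>\<close>
  let ?L = "\<lambda>t. body_momentum l (\<theta> t) (\<psi> t)"
  let ?u = "\<lambda>t. sin (\<theta> t)" and ?x = "\<lambda>t. cos (\<theta> t) * cos (\<psi> t)"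
  let ?P = "vector [l, 0, 0] :: real ^ 3"
  let ?Q = "l *\<^sub>R vector [0, cos \<theta>max, sin \<theta>max] :: real ^ 3"
  have comp: "?L t $ 1 = l * ?x t" "?L t $ 2 = - l * (cos (\<theta> t) * sin (\<psi> t))" "?L t $ 3 = l * ?u t" for t
    by (simp_all add: body_momentum_def)
  have P: "?u t = 0 \<and> cos (\<theta> t) * sin (\<psi> t) = 0" if "?L t = ?P" for t
    using arg_cong[OF that, of "\<lambda>v. v $ 2"] arg_cong[OF that, of "\<lambda>v. v $ 3"] \<open>0 < l\<close>
    unfolding comp by auto
  have Q: "?u t = s \<and> ?x t = 0" if "?L t = ?Q" for t
    using arg_cong[OF that, of "\<lambda>v. v $ 1"] arg_cong[OF that, of "\<lambda>v. v $ 3"] \<open>0 < l\<close> \<open>s = _\<close>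
    unfolding comp by auto
  have ab: "a < b" and ends: "?L a = ?P \<and> ?L b = ?Q \<or> ?L a = ?Q \<and> ?L b = ?P"
    and quad: "\<And>t. t \<in> {a..b} \<Longrightarrow> 0 \<le> ?x t" "\<And>t. t \<in> {a..b} \<Longrightarrow> 0 \<le> ?u t"
    using assms(15) \<open>0 < l\<close> unfolding quadrant_arc_def comp by (auto simp: zero_le_mult_iff)
  obtain t0 where t0: "?L t0 = ?P" using assms(11) by blast
  have lev: "\<gamma> * (?u t)\<^sup>2 + 2 * \<rho> * (cos (\<theta> t) * sin (\<psi> t)) = 0" for t
    using energy_conserved[OF rot, of t t0] P[OF t0] by simp
  have "\<not> (?L a = ?P \<and> ?L b = ?Q)"
  proof
    assume L: "?L a = ?P \<and> ?L b = ?Q"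
    \<comment> \<open>This direction would contradict \<open>L1_pos_after_start\<close>, as \<open>L\<^sub>1\<close> vanishes at the late end.\<close>
    then show False
      using L1_pos_after_start[OF rot \<open>0 < \<gamma>\<close> \<open>0 < \<rho>\<close> lev quad, of a b b] Q[of b] ab by auto
  qed
  with ends have "?L a = ?Q" "?L b = ?P" by auto
  then show ?thesis
    using somersault_from_tilt[OF rot \<open>0 < \<gamma>\<close> \<open>0 < \<rho>\<close> lev quad ab] P[of b] Q[of a] assms(16,17)
    by auto
qed

end
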